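(* Let $X\in\mathbb{R}^{n\times p}$, $Y\in\mathbb{R}^{n\times q}$, $r=\min\{p,q\}$, and suppose that $X^TY\in\mathbb{R}^{p\times q}$ has at least two different singular values among $\sigma_1(X^TY)\ge\dots\ge\sigma_r(X^TY)$. For $i\in\{1,\dots,r\}$ define $$\lambda_i=\frac{\|X^TY\|_2\big(\|X\|_2\|Y\|_F+\sigma_i(X^TY)\big)}{2\|X^TY\|_2-\sigma_i(X^TY)+\|X\|_2\|Y\|_F}.$$ Then for any $i\in\{2,\dots,r\}$ and any $\lambda\in(\lambda_i,\lambda_{i-1}]$, every solution $B^*(\lambda)$ of $\min_{B\in\mathbb{R}^{p\times q}}\{\tfrac12\|Y-XB\|_F^2+\lambda\|B\|_*\}$ satisfies $$\mathrm{rank}(B^*(\lambda))\le i-1.$$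
   Context: For $M\in\mathbb{R}^{p\times q}$, $\sigma_1(M)\ge\dots\ge\sigma_r(M)\ge0$ are its singular values in nonincreasing order (zeros included), $r=\min\{p,q\}$. $\|\cdot\|_F$, $\|\cdot\|_*$, $\|\cdot\|_2$ are the Frobenius, nuclear (sum of singular values) and spectral (largest singular value) norms. *)

theory Defs
  imports "HOL-Analysis.Analysis" "HOL-Computational_Algebra.Computational_Algebra"
begin

text \<open>A real matrix with \<open>p\<close> rows and \<open>q\<close> columns has type \<open>real^'q^'p\<close>, so
  \<open>CARD('p)\<close> and \<open>CARD('q)\<close> play the roles of \<open>p\<close> and \<open>q\<close>.\<close>

definition charpoly :: "real^'n^'n \<Rightarrow> real poly" where
  "charpoly A = det (mat [:0, 1:] - map_matrix (\<lambda>a. [:a:]) A)"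

definition min_dim :: "real^'q^'p \<Rightarrow> nat" where
  "min_dim M = min CARD('p) CARD('q)"

text \<open>The singular values are the square roots of the \<open>min p q\<close> largest eigenvalues of the
  positive semidefinite matrix \<open>M\<^sup>T M\<close>, counted with multiplicity (zeros included), in
  nonincreasing order.  As \<open>M\<^sup>T M\<close> is symmetric, all \<open>q\<close> roots of its characteristic
  polynomial are real, so truncating the list of its real roots leaves exactly \<open>min p q\<close>
  entries; the eigenvalues cut off when \<open>p < q\<close> are zero.\<close>

definition singular_values :: "real^'q^'p \<Rightarrow> real list" where
  "singular_values M =
     take (min_dim M)
       (rev (sorted_list_of_multiset (image_mset sqrt (proots (charpoly (transpose M ** M))))))"

text \<open>The index is 1-based: \<open>singular_value M i\<close> is only meaningful for
  \<open>1 \<le> i \<le> min_dim M\<close>.\<close>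

definition singular_value :: "real^'q^'p \<Rightarrow> nat \<Rightarrow> real" where
  "singular_value M i = singular_values M ! (i - 1)"

definition spectral_norm :: "real^'q^'p \<Rightarrow> real" where
  "spectral_norm M = singular_value M 1"

definition nuclear_norm :: "real^'q^'p \<Rightarrow> real" where
  "nuclear_norm M = (\<Sum>i=1..min_dim M. singular_value M i)"

definition frobenius_norm :: "real^'q^'p \<Rightarrow> real" where
  "frobenius_norm M = sqrt (\<Sum>i\<in>UNIV. \<Sum>j\<in>UNIV. (M $ i $ j)\<^sup>2)"

lemma frobenius_norm_eq_norm: "frobenius_norm M = norm M"
  by (simp add: frobenius_norm_def norm_vec_def L2_set_def sum_nonneg)

definition objective :: "real^'p^'n \<Rightarrow> real^'q^'n \<Rightarrow> real \<Rightarrow> real^'q^'p \<Rightarrow> real" where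
  "objective X Y lam B = 1 / 2 * (frobenius_norm (Y - X ** B))\<^sup>2 + lam * nuclear_norm B"

definition rank_threshold :: "real^'p^'n \<Rightarrow> real^'q^'n \<Rightarrow> nat \<Rightarrow> real" where
  "rank_threshold X Y i =
     (let C = transpose X ** Y in
        spectral_norm C * (spectral_norm X * frobenius_norm Y + singular_value C i)
        / (2 * spectral_norm C - singular_value C i + spectral_norm X * frobenius_norm Y))"

end

theory Submission
  imports Defs
begin

text \<open>
  Write \<open>C = X\<^sup>T Y\<close>, with singular values \<open>\<sigma>\<^sub>1 \<ge> \<sigma>\<^sub>2 \<ge> \<dots>\<close>, and let \<open>R = Y - X B\<close> be the residual of a
  solution \<open>B\<close>.  Optimality says that \<open>G = X\<^sup>T R / lam\<close> has spectral norm at most 1 and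
  \<open>\<langle>G, B\<rangle> = \<parallel>B\<parallel>\<^sub>*\<close>, so \<open>G\<close> is isometric on the span of the right singular vectors of \<open>B\<close> with
  nonzero singular value.  Were the rank of \<open>B\<close> at least \<open>i\<close>, this span would contain a unit vector
  \<open>x\<close> orthogonal to the first \<open>i - 1\<close> right singular vectors of \<open>C\<close>, so \<open>\<parallel>C x\<parallel> \<le> \<sigma>\<^sub>i\<close>.  As \<open>R / lam\<close> lies in
  the ball with diameter from \<open>Y / lam\<close> to \<open>Y / \<sigma>\<^sub>1\<close>, this gives
  \<open>1 = \<parallel>G x\<parallel> \<le> (1 / lam + 1 / \<sigma>\<^sub>1) \<sigma>\<^sub>i / 2 + (1 / lam - 1 / \<sigma>\<^sub>1) \<parallel>X\<parallel>\<^sub>2 \<parallel>Y\<parallel>\<^sub>F / 2\<close>, which rearranges to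
  \<open>lam \<le> \<lambda>\<^sub>i\<close>.
\<close>

section \<open>Existence of orthonormal right singular vectors\<close>

text \<open>Compactness: the unit vectors orthogonal to \<open>E\<close> form a compact set,
  nonempty because \<open>E\<close> has fewer than \<open>CARD('q)\<close> elements. Homogeneity
  extends the bound from unit vectors to every \<open>y\<close>.\<close>

lemma ex_norm_maximiser:
  fixes M :: "real^'q^'p" and E :: "(real^'q) set"
  assumes "finite E" "card E < CARD('q)"
  obtains x where "norm x = 1" "\<forall>e\<in>E. e \<bullet> x = 0"
    "\<And>y. \<lbrakk>\<forall>e\<in>E. e \<bullet> y = 0\<rbrakk> \<Longrightarrow> norm (M *v y) \<le> norm (M *v x) * norm y"
proof -
  let ?S = "{x. \<forall>e\<in>E. e \<bullet> x = 0}"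
  have clo: "closed ?S"
  proof -
    have "?S = (\<Inter>e\<in>E. {x. e \<bullet> x = 0})" by auto
    then show ?thesis by (simp add: closed_INT closed_hyperplane)
  qed
  have "dim E < DIM(real^'q)"
    using assms dim_le_card'[of E] by simp
  then obtain z where z: "z \<noteq> 0" "\<And>y. y \<in> span E \<Longrightarrow> orthogonal z y"
    using orthogonal_to_subspace_exists[of E] by auto
  have zS: "z \<in> ?S"
    using z(2) span_base[of _ E] by (auto simp: orthogonal_def inner_commute)
  let ?K = "sphere 0 1 \<inter> ?S"
  have "compact ?K" using clo by (simp add: compact_Int_closed)
  moreover have "(1 / norm z) *\<^sub>R z \<in> ?K" using z(1) zS by simp
  moreover have "continuous_on ?K (\<lambda>x. norm (M *v x))"
    by (intro continuous_intros linear_continuous_on matrix_vector_mul_bounded_linear)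
  ultimately obtain x where x: "x \<in> ?K" "\<And>y. y \<in> ?K \<Longrightarrow> norm (M *v y) \<le> norm (M *v x)"
    using continuous_attains_sup[of ?K "\<lambda>x. norm (M *v x)"] by blast
  show ?thesis
  proof (rule that[of x])
    fix y assume y: "\<forall>e\<in>E. e \<bullet> y = 0"
    show "norm (M *v y) \<le> norm (M *v x) * norm y"
    proof (cases "y = 0")
      case False
      then have "(1 / norm y) *\<^sub>R y \<in> ?K" using y by simp
      from x(2)[OF this] False show ?thesis
        by (simp add: scaleR_matrix_vector_assoc[symmetric] matrix_vector_mult_scaleR field_simps)
    qed simp
  qed (use x(1) in auto)
qed

text \<open>First-order condition: moving \<open>x\<close> along an orthogonal \<open>y\<close>
  changes the squared norm of the image by a term linear in \<open>t\<close>, which maximality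
  forces to vanish. Maximality is assumed only along this line, so \<open>x\<close> may be a
  maximiser on a mere subspace.\<close>

lemma norm_maximiser_orthogonal:
  fixes M :: "real^'q^'p"
  assumes x: "norm x = 1" and xy: "x \<bullet> y = 0"
    and max: "\<And>t. norm (M *v (x + t *\<^sub>R y)) \<le> norm (M *v x) * norm (x + t *\<^sub>R y)"
  shows "(M *v x) \<bullet> (M *v y) = 0"
proof (rule ccontr)
  define a where "a = (M *v x) \<bullet> (M *v y)"
  define b where "b = (norm (M *v x))\<^sup>2 * (norm y)\<^sup>2"
  assume "(M *v x) \<bullet> (M *v y) \<noteq> 0"
  then have a: "a \<noteq> 0" by (simp add: a_def)
  have b: "b \<ge> 0" by (simp add: b_def)
  have *: "2 * t * a \<le> t\<^sup>2 * b" for t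
  proof -
    have "(norm (M *v (x + t *\<^sub>R y)))\<^sup>2 \<le> (norm (M *v x))\<^sup>2 * (norm (x + t *\<^sub>R y))\<^sup>2"
      using power_mono[OF max[of t], of 2] by (simp add: power_mult_distrib)
    moreover have "(norm (M *v (x + t *\<^sub>R y)))\<^sup>2 = (norm (M *v x))\<^sup>2 + 2 * t * a + t\<^sup>2 * (norm (M *v y))\<^sup>2"
      unfolding power2_norm_eq_inner a_def
      by (simp add: matrix_vector_right_distrib matrix_vector_mult_scaleR inner_simps
          inner_commute[of "M *v y" "M *v x"] algebra_simps power2_eq_square)
    moreover have "(norm (x + t *\<^sub>R y))\<^sup>2 = 1 + t\<^sup>2 * (norm y)\<^sup>2"
    proof -
      have "x \<bullet> x = 1" using x by (simp add: norm_eq_1)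
      then show ?thesis using xy unfolding power2_norm_eq_inner
        by (simp add: inner_simps inner_commute[of y x] power2_eq_square)
    qed
    ultimately have "2 * t * a + t\<^sup>2 * (norm (M *v y))\<^sup>2 \<le> t\<^sup>2 * b"
      by (simp add: b_def algebra_simps)
    moreover have "0 \<le> t\<^sup>2 * (norm (M *v y))\<^sup>2" by simp
    ultimately show ?thesis by linarith
  qed
  \<comment> \<open>With this \<open>t\<close>, the bound
    \<open>2 * t * a \<le> t\<^sup>2 * b\<close> turns into \<open>2 * (b + 1) \<le> b\<close>;
    adding 1 keeps the denominator positive even if \<open>b = 0\<close>.\<close>
  define t where "t = a / (b + 1)"
  have t: "a = t * (b + 1)" "t \<noteq> 0" using a b by (auto simp: t_def)
  have "t\<^sup>2 * (2 * (b + 1)) \<le> t\<^sup>2 * b"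
    using *[of t] by (subst (asm) t(1)) (simp add: power2_eq_square mult.assoc mult.left_commute)
  then have "2 * (b + 1) \<le> b" using t(2) mult_le_cancel_left_pos[of "t\<^sup>2" "2 * (b + 1)" b] by simp
  then show False using b by simp
qed

text \<open>The last conjunct makes the greedy construction of singular vectors work: a further maximiser
  stays orthogonal, and has orthogonal image, to those already chosen.\<close>

lemma ex_partial_singular_vectors:
  fixes M :: "real^'q^'p"
  assumes "n \<le> CARD('q)"
  shows "\<exists>E :: (real^'q) set. finite E \<and> card E = n \<and> pairwise orthogonal E \<and> (\<forall>e\<in>E. norm e = 1)
    \<and> pairwise (\<lambda>e f. (M *v e) \<bullet> (M *v f) = 0) E
    \<and> (\<forall>y. (\<forall>e\<in>E. e \<bullet> y = 0) \<longrightarrow> (\<forall>e\<in>E. (M *v e) \<bullet> (M *v y) = 0))"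
  using assms
proof (induction n)
  case 0
  show ?case by (rule exI[of _ "{}"]) (auto simp: pairwise_def)
next
  case (Suc n)
  then obtain E :: "(real^'q) set" where E: "finite E" "card E = n" "pairwise orthogonal E"
      "\<forall>e\<in>E. norm e = 1" "pairwise (\<lambda>e f. (M *v e) \<bullet> (M *v f) = 0) E"
      and Eo: "\<And>y e. \<lbrakk>\<forall>e\<in>E. e \<bullet> y = 0; e \<in> E\<rbrakk> \<Longrightarrow> (M *v e) \<bullet> (M *v y) = 0"
    by (metis Suc_leD)
  obtain x where x: "norm x = 1" "\<forall>e\<in>E. e \<bullet> x = 0"
    "\<And>y. \<lbrakk>\<forall>e\<in>E. e \<bullet> y = 0\<rbrakk> \<Longrightarrow> norm (M *v y) \<le> norm (M *v x) * norm y"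
    using ex_norm_maximiser[of E M] E Suc.prems by auto
  have xE: "x \<notin> E" using x(1,2) by auto
  have new: "(M *v x) \<bullet> (M *v y) = 0" if "\<forall>e\<in>E. e \<bullet> y = 0" "x \<bullet> y = 0" for y
  proof (rule norm_maximiser_orthogonal[OF x(1) that(2)])
    fix t show "norm (M *v (x + t *\<^sub>R y)) \<le> norm (M *v x) * norm (x + t *\<^sub>R y)"
      using x(2) that(1) by (intro x(3)) (simp add: inner_simps)
  qed
  show ?case
  proof (intro exI[of _ "insert x E"] conjI)
    show "pairwise orthogonal (insert x E)"
      using E(3) x(2) by (auto simp: pairwise_insert orthogonal_def inner_commute)
    show "pairwise (\<lambda>e f. (M *v e) \<bullet> (M *v f) = 0) (insert x E)"
      using E(5) Eo[OF x(2)] by (auto simp: pairwise_insert inner_commute)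
  qed (use E x xE new Eo in auto)
qed

text \<open>The greedy construction run for \<open>CARD('q)\<close> rounds yields a set, which does
  not record the order of choice; sorting by the norm of the image recovers the decreasing
  order.\<close>

lemma ex_singular_vectors:
  fixes M :: "real^'q^'p"
  obtains v :: "nat \<Rightarrow> real^'q" where
    "\<And>j k. \<lbrakk>j < CARD('q); k < CARD('q)\<rbrakk> \<Longrightarrow> v j \<bullet> v k = (if j = k then 1 else 0)"
    "\<And>j k. \<lbrakk>j < CARD('q); k < CARD('q); j \<noteq> k\<rbrakk> \<Longrightarrow> (M *v v j) \<bullet> (M *v v k) = 0"
    "\<And>j k. \<lbrakk>j \<le> k; k < CARD('q)\<rbrakk> \<Longrightarrow> norm (M *v v k) \<le> norm (M *v v j)"
proof -
  obtain E :: "(real^'q) set" where E: "finite E" "card E = CARD('q)" "pairwise orthogonal E"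
      "\<forall>e\<in>E. norm e = 1" "pairwise (\<lambda>e f. (M *v e) \<bullet> (M *v f) = 0) E"
    using ex_partial_singular_vectors[of "CARD('q)" M] by auto
  obtain xs where xs: "set xs = E" "distinct xs" 
    using finite_distinct_list[OF E(1)] by auto
  define ys where "ys = sort_key (\<lambda>x. - norm (M *v x)) xs"
  have ys: "set ys = E" "distinct ys" "sorted (map (\<lambda>x. - norm (M *v x)) ys)"
    using xs by (auto simp: ys_def)
  have len: "length ys = CARD('q)" using ys E(2) distinct_card by fastforce
  show ?thesis
  proof (rule that[of "\<lambda>k. ys ! k"])
    fix j k :: nat assume jk: "j < CARD('q)" "k < CARD('q)"
    have inE: "ys ! j \<in> E" "ys ! k \<in> E" using ys(1) len jk by auto
    have neq: "j \<noteq> k \<Longrightarrow> ys ! j \<noteq> ys ! k" using ys(2) len jk by (simp add: nth_eq_iff_index_eq)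
    show "ys ! j \<bullet> ys ! k = (if j = k then 1 else 0)"
      using inE neq E(3,4) by (auto simp: pairwise_def orthogonal_def norm_eq_1)
    show "(M *v ys ! j) \<bullet> (M *v ys ! k) = 0" if "j \<noteq> k"
      using inE neq[OF that] E(5) by (auto simp: pairwise_def)
  next
    fix j k :: nat assume "j \<le> k" "k < CARD('q)"
    with sorted_nth_mono[OF ys(3), of j k] len show "norm (M *v ys ! k) \<le> norm (M *v ys ! j)"
      by simp
  qed
qed

section \<open>Characteristic polynomial and singular values in terms of a singular basis\<close>

lemma map_matrix_const_mult:
  fixes A :: "real^'n^'m" and B :: "real^'k^'n"
  shows "map_matrix (\<lambda>a. [:a:]) (A ** B) = map_matrix (\<lambda>a. [:a:]) A ** map_matrix (\<lambda>a. [:a:]) B"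
proof -
  have "[:sum f S:] = (\<Sum>x\<in>S. [:f x:])" for f :: "'n \<Rightarrow> real" and S
    by (intro poly_eqI) (simp add: coeff_sum coeff_pCons split: nat.split)
  then show ?thesis
    by (simp add: vec_eq_iff matrix_matrix_mult_def mult.commute)
qed

text \<open>Diagonalisation over the polynomial ring: if \<open>P\<close> has the columns
  \<open>w j\<close> and \<open>U\<close> is diagonal with entries \<open>[:- \<mu> j, 1:]\<close>,
  then \<open>?L ** ?K P = ?K P ** U\<close>. Taking determinants, the factor
  \<open>det (?K P)\<close> cancels, being nonzero by orthonormality.\<close>

lemma charpoly_orthonormal_eigenbasis:
  fixes A :: "real^'n^'n" and w :: "'n \<Rightarrow> real^'n"
  assumes orth: "\<And>j k. w j \<bullet> w k = (if j = k then 1 else 0)"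
    and eig: "\<And>j. A *v w j = \<mu> j *\<^sub>R w j"
  shows "charpoly A = (\<Prod>j\<in>UNIV. [:- \<mu> j, 1:])"
proof -
  let ?K = "map_matrix (\<lambda>a. [:a:])"
  define P :: "real^'n^'n" where "P = (\<chi> i j. w j $ i)"
  define U :: "(real poly)^'n^'n" where "U = (\<chi> i j. if i = j then [:- \<mu> j, 1:] else 0)"
  let ?L = "mat [:0, 1:] - ?K A :: (real poly)^'n^'n"
  have "transpose P ** P = mat 1"
    using orth by (simp add: P_def matrix_matrix_mult_def transpose_def vec_eq_iff mat_def inner_vec_def)
  then have "?K (transpose P) ** ?K P = ?K (mat 1)"
    by (simp add: map_matrix_const_mult[symmetric])
  also have "\<dots> = mat 1" by (simp add: vec_eq_iff mat_def)
  finally have "det (?K (transpose P)) * det (?K P) = 1"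
    by (metis det_I det_mul)
  then have nz: "det (?K P) \<noteq> 0" by auto
  have "?L ** ?K P = ?K P ** U"
  proof -
    have 1: "(mat [:0, 1:] ** ?K P) $ i $ j = [:0,1:] * [:w j $ i:]" for i j
    proof -
      have "(mat [:0, 1:] ** ?K P) $ i $ j = (\<Sum>k\<in>UNIV. if k = i then [:0,1:] * [:w j $ k:] else 0)"
        unfolding matrix_matrix_mult_def vec_lambda_beta by (rule sum.cong) (auto simp: mat_def P_def)
      then show ?thesis by simp
    qed
    have 2: "(?K A ** ?K P) $ i $ j = [:\<mu> j * w j $ i:]" for i j
    proof -
      have "(?K A ** ?K P) $ i $ j = [:(A ** P) $ i $ j:]"
        by (simp add: map_matrix_const_mult[symmetric])
      also have "(A ** P) $ i $ j = (A *v w j) $ i"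
        by (simp add: matrix_matrix_mult_def matrix_vector_mult_def P_def)
      finally show ?thesis by (simp add: eig)
    qed
    have 3: "(?K P ** U) $ i $ j = [:w j $ i:] * [:- \<mu> j, 1:]" for i j
    proof -
      have "(?K P ** U) $ i $ j = (\<Sum>k\<in>UNIV. if k = j then [:w k $ i:] * [:- \<mu> k, 1:] else 0)"
        unfolding matrix_matrix_mult_def vec_lambda_beta by (rule sum.cong) (auto simp: U_def P_def)
      then show ?thesis by simp
    qed
    have 4: "(?L ** ?K P) = mat [:0, 1:] ** ?K P - ?K A ** ?K P"
      unfolding vec_eq_iff matrix_matrix_mult_def vec_lambda_beta vector_minus_component
        left_diff_distrib sum_subtractf by simp
    show ?thesis
      unfolding 4 by (simp add: vec_eq_iff 1 2 3 del: nth_map_matrix)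
  qed
  then have "det ?L * det (?K P) = det (?K P) * det U"
    by (metis det_mul)
  then have "det ?L = det U" using nz by simp
  also have "det U = (\<Prod>j\<in>UNIV. [:- \<mu> j, 1:])"
    by (subst det_diagonal) (simp_all add: U_def)
  finally show ?thesis by (simp add: charpoly_def)
qed

text \<open>The remainder \<open>d\<close> is orthogonal to every \<open>v j\<close>; as
  \<open>CARD('q)\<close> orthonormal vectors span the space, \<open>d\<close> is orthogonal to
  itself.\<close>

lemma orthonormal_expansion:
  fixes v :: "nat \<Rightarrow> real^'q"
  assumes orth: "\<And>j k. \<lbrakk>j < CARD('q); k < CARD('q)\<rbrakk> \<Longrightarrow> v j \<bullet> v k = (if j = k then 1 else 0)"
  shows "(\<Sum>k<CARD('q). (v k \<bullet> x) *\<^sub>R v k) = x"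
proof -
  have inj: "inj_on v {..<CARD('q)}"
    by (rule inj_onI) (metis lessThan_iff orth zero_neq_one)
  let ?E = "v ` {..<CARD('q)}"
  have po: "pairwise orthogonal ?E"
    using orth by (auto simp: pairwise_def orthogonal_def)
  have nz: "0 \<notin> ?E" using orth by (auto, metis inner_zero_left zero_neq_one)
  have "independent ?E" by (rule pairwise_orthogonal_independent[OF po nz])
  moreover have "card ?E = dim (UNIV :: (real^'q) set)"
    using inj by (simp add: card_image)
  ultimately have span: "span ?E = UNIV"
    using card_eq_dim[of ?E UNIV] by auto
  define d where "d = x - (\<Sum>k<CARD('q). (v k \<bullet> x) *\<^sub>R v k)"
  have "v j \<bullet> d = 0" if "j < CARD('q)" for j
  proof -
    have "(\<Sum>k<CARD('q). (v k \<bullet> x) * (v j \<bullet> v k)) = (\<Sum>k<CARD('q). if k = j then v j \<bullet> x else 0)"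
      using that by (intro sum.cong) (auto simp: orth)
    then show ?thesis using that by (simp add: d_def inner_diff_right inner_sum_right)
  qed
  then have "orthogonal d y" if "y \<in> ?E" for y
    using that by (auto simp: orthogonal_def inner_commute)
  then have "orthogonal d d" using orthogonal_to_span[of d ?E d] span by blast
  then show ?thesis by (simp add: d_def orthogonal_def)
qed

lemma inner_transpose_mult: "(transpose A *v x) \<bullet> y = x \<bullet> (A *v y)" for A :: "real^'n^'m"
  by (metis dot_lmul_matrix transpose_matrix_vector)

lemma orthonormal_parseval:
  fixes v :: "nat \<Rightarrow> real^'q"
  assumes orth: "\<And>j k. \<lbrakk>j < CARD('q); k < CARD('q)\<rbrakk> \<Longrightarrow> v j \<bullet> v k = (if j = k then 1 else 0)"
  shows "(\<Sum>k<CARD('q). (v k \<bullet> x) * (v k \<bullet> y)) = x \<bullet> y"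
  using arg_cong[OF orthonormal_expansion[OF orth, of x], of "\<lambda>z. z \<bullet> y"]
  by (simp add: inner_sum_left)

lemma orthonormal_sum_power2:
  fixes v :: "nat \<Rightarrow> real^'q"
  assumes orth: "\<And>j k. \<lbrakk>j < CARD('q); k < CARD('q)\<rbrakk> \<Longrightarrow> v j \<bullet> v k = (if j = k then 1 else 0)"
  shows "(\<Sum>k<CARD('q). (v k \<bullet> x)\<^sup>2) = (norm x)\<^sup>2"
  by (simp only: orthonormal_parseval[OF orth] power2_norm_eq_inner power2_eq_square[of "_ \<bullet> _"])

text \<open>An ordered orthonormal eigenbasis of \<open>transpose M ** M\<close>, described without
  eigenvalues. Counting starts at 0, so \<open>v k\<close> belongs to the singular value number
  \<open>k + 1\<close>; all \<open>CARD('q)\<close> vectors are included, those past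
  \<open>min_dim M\<close> being in the kernel.\<close>

definition singular_basis :: "real^'q^'p \<Rightarrow> (nat \<Rightarrow> real^'q) \<Rightarrow> bool" where
  "singular_basis M v \<longleftrightarrow>
     (\<forall>j<CARD('q). \<forall>k<CARD('q). v j \<bullet> v k = (if j = k then 1 else 0)) \<and>
     (\<forall>j<CARD('q). \<forall>k<CARD('q). j \<noteq> k \<longrightarrow> (M *v v j) \<bullet> (M *v v k) = 0) \<and>
     (\<forall>k<CARD('q). \<forall>j\<le>k. norm (M *v v k) \<le> norm (M *v v j))"

lemma singular_basisD:
  fixes M :: "real^'q^'p"
  assumes "singular_basis M v"
  shows "\<And>j k. \<lbrakk>j < CARD('q); k < CARD('q)\<rbrakk> \<Longrightarrow> v j \<bullet> v k = (if j = k then 1 else 0)"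
    and "\<And>j k. \<lbrakk>j < CARD('q); k < CARD('q); j \<noteq> k\<rbrakk> \<Longrightarrow> (M *v v j) \<bullet> (M *v v k) = 0"
    and "\<And>j k. \<lbrakk>j \<le> k; k < CARD('q)\<rbrakk> \<Longrightarrow> norm (M *v v k) \<le> norm (M *v v j)"
  using assms by (auto simp: singular_basis_def)

text \<open>Each \<open>v k\<close> is an eigenvector of \<open>transpose M ** M\<close> with
  eigenvalue the squared norm of \<open>M *v v k\<close>, so the characteristic polynomial splits
  and its root multiset is known. This ties the definition by roots to geometry.\<close>

lemma singular_values_singular_basis:
  fixes M :: "real^'q^'p"
  assumes sb: "singular_basis M v"
  shows "singular_values M = take (min_dim M) (map (\<lambda>k. norm (M *v v k)) [0..<CARD('q)])"
proof -
  note orth = singular_basisD[OF sb]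
  \<comment> \<open>The determinant is indexed by the type \<open>'q\<close>, the basis by numbers;
    \<open>f\<close> translates between them.\<close>
  obtain f :: "'q \<Rightarrow> nat" where f: "bij_betw f UNIV {..<CARD('q)}"
    using ex_bij_betw_finite_nat[of "UNIV :: 'q set"] by (auto simp: atLeast0LessThan)
  have fl: "f j < CARD('q)" for j using f by (auto simp: bij_betw_def)
  have fi: "f j = f k \<longleftrightarrow> j = k" for j k using f by (auto simp: bij_betw_def inj_eq)
  have eig: "(transpose M ** M) *v v k = (norm (M *v v k))\<^sup>2 *\<^sub>R v k" if k: "k < CARD('q)" for k
  proof -
    let ?x = "(transpose M ** M) *v v k"
    have "v j \<bullet> ?x = (if j = k then (norm (M *v v k))\<^sup>2 else 0)" if "j < CARD('q)" for j
    proof -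
      have "v j \<bullet> ?x = (M *v v j) \<bullet> (M *v v k)"
        by (metis inner_commute inner_transpose_mult matrix_vector_mul_assoc)
      then show ?thesis using orth(2)[OF that k] by (auto simp: power2_norm_eq_inner)
    qed
    then have "(\<Sum>j<CARD('q). (v j \<bullet> ?x) *\<^sub>R v j)
        = (\<Sum>j<CARD('q). if j = k then (norm (M *v v k))\<^sup>2 *\<^sub>R v k else 0)"
      by (intro sum.cong) auto
    then show ?thesis using orthonormal_expansion[OF orth(1), of ?x] k by simp
  qed
  have "charpoly (transpose M ** M) = (\<Prod>j\<in>UNIV. [:- (norm (M *v v (f j)))\<^sup>2, 1:])"
    by (rule charpoly_orthonormal_eigenbasis[where w = "\<lambda>j. v (f j)"]) (auto simp: orth fl fi eig)
  also have "\<dots> = (\<Prod>k<CARD('q). [:- (norm (M *v v k))\<^sup>2, 1:])"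
    by (rule prod.reindex_bij_betw[OF f])
  finally have "proots (charpoly (transpose M ** M)) = (\<Sum>k<CARD('q). {#(norm (M *v v k))\<^sup>2#})"
    by (simp add: proots_prod)
  also have "\<dots> = image_mset (\<lambda>k. (norm (M *v v k))\<^sup>2) (mset_set {..<CARD('q)})"
    by (simp add: sum_unfold_sum_mset)
  finally have "image_mset sqrt (proots (charpoly (transpose M ** M)))
      = image_mset (\<lambda>k. norm (M *v v k)) (mset_set {..<CARD('q)})"
    by (simp add: image_mset.compositionality o_def)
  also have "\<dots> = mset (map (\<lambda>k. norm (M *v v k)) [0..<CARD('q)])"
    by (simp add: atLeast0LessThan)
  finally have 1: "sorted_list_of_multiset (image_mset sqrt (proots (charpoly (transpose M ** M))))
      = sort (map (\<lambda>k. norm (M *v v k)) [0..<CARD('q)])"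
    by (simp only: sorted_list_of_multiset_mset)
  \<comment> \<open>The norms already decrease, so sorting merely reverses the list, and the
    \<open>rev\<close> in \<open>singular_values\<close> undoes this.\<close>
  have "sort (map (\<lambda>k. norm (M *v v k)) [0..<CARD('q)]) = rev (map (\<lambda>k. norm (M *v v k)) [0..<CARD('q)])"
    by (rule properties_for_sort)
      (auto simp: sorted_rev_iff_nth_mono orth(3))
  then show ?thesis by (simp add: singular_values_def 1)
qed

lemma ex_singular_basis: "\<exists>v. singular_basis M v" for M :: "real^'q^'p"
proof -
  obtain v :: "nat \<Rightarrow> real^'q" where 
    "\<And>j k. \<lbrakk>j < CARD('q); k < CARD('q)\<rbrakk> \<Longrightarrow> v j \<bullet> v k = (if j = k then 1 else 0)"
    "\<And>j k. \<lbrakk>j < CARD('q); k < CARD('q); j \<noteq> k\<rbrakk> \<Longrightarrow> (M *v v j) \<bullet> (M *v v k) = 0"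
    "\<And>j k. \<lbrakk>j \<le> k; k < CARD('q)\<rbrakk> \<Longrightarrow> norm (M *v v k) \<le> norm (M *v v j)"
    by (rule ex_singular_vectors[of M]) blast
  then show ?thesis unfolding singular_basis_def by blast
qed

lemma singular_value_singular_basis:
  fixes M :: "real^'q^'p"
  assumes "singular_basis M v" "1 \<le> i" "i \<le> min_dim M"
  shows "singular_value M i = norm (M *v v (i - 1))"
proof -
  have "i - 1 < min_dim M" "min_dim M \<le> CARD('q)" using assms by (auto simp: min_dim_def)
  then show ?thesis
    by (simp add: singular_value_def singular_values_singular_basis[OF assms(1)])
qed

text \<open>Here \<open>min_dim M\<close> must be \<open>CARD('p)\<close>. A nonzero image at
  \<open>k\<close> would make the images of \<open>v 0\<close> to \<open>v k\<close> more than
  \<open>CARD('p)\<close> nonzero orthogonal vectors in a space of dimension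
  \<open>CARD('p)\<close>.\<close>

lemma singular_basis_beyond_min_dim:
  fixes M :: "real^'q^'p"
  assumes sb: "singular_basis M v" and k: "min_dim M \<le> k" "k < CARD('q)"
  shows "M *v v k = 0"
proof (rule ccontr)
  assume nz: "M *v v k \<noteq> 0"
  have nzj: "M *v v j \<noteq> 0" if "j \<le> k" for j
    using singular_basisD(3)[OF sb that k(2)] nz by auto
  let ?E = "(\<lambda>j. M *v v j) ` {..k}"
  have inj: "inj_on (\<lambda>j. M *v v j) {..k}"
  proof (rule inj_onI, rule ccontr)
    fix i j assume ij: "i \<in> {..k}" "j \<in> {..k}" "M *v v i = M *v v j" "i \<noteq> j"
    then have "(M *v v i) \<bullet> (M *v v j) = 0"
      using k(2) by (intro singular_basisD(2)[OF sb]) auto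
    with ij nzj[of i] show False by simp
  qed
  have "pairwise orthogonal ?E"
    unfolding pairwise_image
  proof (intro pairwiseI impI)
    fix i j assume "i \<in> {..k}" "j \<in> {..k}" "i \<noteq> j"
    then show "orthogonal (M *v v i) (M *v v j)"
      unfolding orthogonal_def using k(2) by (intro singular_basisD(2)[OF sb]) auto
  qed
  moreover have "0 \<notin> ?E" using nzj by force
  ultimately have "independent ?E" by (rule pairwise_orthogonal_independent)
  then have "card ?E \<le> CARD('p)" using independent_card_le_dim[of ?E UNIV] by simp
  then show False using inj k by (simp add: card_image min_dim_def)
qed

section \<open>Nuclear and spectral norms and their duality\<close>

lemma nuclear_norm_singular_basis:
  fixes M :: "real^'q^'p"
  assumes sb: "singular_basis M v"
  shows "nuclear_norm M = (\<Sum>k<CARD('q). norm (M *v v k))"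
proof -
  have "nuclear_norm M = (\<Sum>i=1..min_dim M. norm (M *v v (i - 1)))"
    unfolding nuclear_norm_def by (intro sum.cong) (auto simp: singular_value_singular_basis[OF sb])
  also have "\<dots> = (\<Sum>k<min_dim M. norm (M *v v k))"
    by (rule sum.reindex_bij_witness[of _ Suc "\<lambda>i. i - 1"]) auto
  also have "\<dots> = (\<Sum>k<CARD('q). norm (M *v v k))"
    by (rule sum.mono_neutral_left)
      (auto simp: min_dim_def singular_basis_beyond_min_dim[OF sb])
  finally show ?thesis .
qed

text \<open>This is the trace of \<open>transpose A ** M\<close> computed in the basis
  \<open>v\<close>, obtained from Parseval on each row.\<close>

lemma inner_matrix_orthonormal:
  fixes A M :: "real^'q^'p" and v :: "nat \<Rightarrow> real^'q"
  assumes orth: "\<And>j k. \<lbrakk>j < CARD('q); k < CARD('q)\<rbrakk> \<Longrightarrow> v j \<bullet> v k = (if j = k then 1 else 0)"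
  shows "A \<bullet> M = (\<Sum>k<CARD('q). (A *v v k) \<bullet> (M *v v k))"
proof -
  have "A \<bullet> M = (\<Sum>i\<in>UNIV. \<Sum>k<CARD('q). (v k \<bullet> A $ i) * (v k \<bullet> M $ i))"
    unfolding inner_vec_def[of A M] by (simp only: orthonormal_parseval[OF orth])
  also have "\<dots> = (\<Sum>k<CARD('q). (A *v v k) \<bullet> (M *v v k))"
    unfolding inner_vec_def[of "A *v _" "M *v _"]
    by (subst sum.swap) (simp add: matrix_vector_mul_component inner_commute)
  finally show ?thesis .
qed

lemma matrix_vector_mult_sum_scaleR:
  "M *v (\<Sum>k\<in>I. c k *\<^sub>R v k) = (\<Sum>k\<in>I. c k *\<^sub>R (M *v v k))" for M :: "real^'q^'p"
  by (simp add: linear_sum[OF matrix_vector_mul_linear] matrix_vector_mult_scaleR o_def)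

lemma norm_sum_orthogonal:
  assumes "finite I" "\<And>j k. \<lbrakk>j \<in> I; k \<in> I; j \<noteq> k\<rbrakk> \<Longrightarrow> u j \<bullet> u k = 0"
  shows "(norm (\<Sum>k\<in>I. c k *\<^sub>R u k))\<^sup>2 = (\<Sum>k\<in>I. (c k)\<^sup>2 * (norm (u k))\<^sup>2)"
  using norm_sum_Pythagorean[OF assms(1), of "\<lambda>k. c k *\<^sub>R u k"] assms(2)
  by (simp add: pairwise_def orthogonal_def power_mult_distrib)

text \<open>One half of the min-max principle: the first \<open>m\<close> coefficients of
  \<open>x\<close> vanish, and the orthogonal images of the other basis vectors have norm at most
  that of \<open>M *v v m\<close>.\<close>

lemma norm_mult_le_singular:
  fixes M :: "real^'q^'p"
  assumes sb: "singular_basis M v" and m: "m < CARD('q)" and x: "\<And>k. k < m \<Longrightarrow> v k \<bullet> x = 0"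
  shows "norm (M *v x) \<le> norm (M *v v m) * norm x"
proof -
  note orth = singular_basisD[OF sb]
  have "M *v x = (\<Sum>k<CARD('q). (v k \<bullet> x) *\<^sub>R (M *v v k))"
    using matrix_vector_mult_sum_scaleR[of M "\<lambda>k. v k \<bullet> x" v "{..<CARD('q)}"]
    by (simp only: orthonormal_expansion[OF orth(1)])
  then have "(norm (M *v x))\<^sup>2 = (\<Sum>k<CARD('q). (v k \<bullet> x)\<^sup>2 * (norm (M *v v k))\<^sup>2)"
    by (simp only:) (rule norm_sum_orthogonal, simp_all add: orth(2))
  also have "\<dots> \<le> (\<Sum>k<CARD('q). (v k \<bullet> x)\<^sup>2 * (norm (M *v v m))\<^sup>2)"
  proof (intro sum_mono)
    fix k assume k: "k \<in> {..<CARD('q)}"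
    show "(v k \<bullet> x)\<^sup>2 * (norm (M *v v k))\<^sup>2 \<le> (v k \<bullet> x)\<^sup>2 * (norm (M *v v m))\<^sup>2"
    proof (cases "k < m")
      case False
      then show ?thesis using orth(3)[of m k] k by (intro mult_left_mono power_mono) auto
    qed (simp add: x)
  qed
  also have "\<dots> = (norm x)\<^sup>2 * (norm (M *v v m))\<^sup>2"
    using orthonormal_sum_power2[OF orth(1), of x] by (simp add: sum_distrib_right[symmetric])
  finally have "(norm (M *v x))\<^sup>2 \<le> (norm (M *v v m) * norm x)\<^sup>2"
    by (simp add: power_mult_distrib mult.commute)
  then show ?thesis by (rule power2_le_imp_le) simp
qed

lemma spectral_norm_singular_basis:
  fixes M :: "real^'q^'p"
  assumes "singular_basis M v"
  shows "spectral_norm M = norm (M *v v 0)"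
  unfolding spectral_norm_def
  by (subst singular_value_singular_basis[OF assms]) (simp_all add: min_dim_def Suc_le_eq)

lemma norm_mult_le_spectral_norm: "norm (M *v x) \<le> spectral_norm M * norm x"
  using ex_singular_basis[of M] norm_mult_le_singular[of M _ 0]
  by (auto simp: spectral_norm_singular_basis)

lemma spectral_norm_nonneg: "0 \<le> spectral_norm M"
  using ex_singular_basis[of M] by (auto simp: spectral_norm_singular_basis)

text \<open>Moving the transpose across the inner product and cancelling one factor avoids comparing
  the singular values of \<open>M\<close> and its transpose.\<close>

lemma norm_transpose_mult_le_spectral_norm: "norm (transpose M *v y) \<le> spectral_norm M * norm y"
proof (cases "transpose M *v y = 0")
  case False
  let ?x = "transpose M *v y"
  have "norm ?x * norm ?x = y \<bullet> (M *v ?x)"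
    by (metis inner_transpose_mult power2_eq_square power2_norm_eq_inner)
  also have "\<dots> \<le> norm y * (spectral_norm M * norm ?x)"
    by (rule order_trans[OF norm_cauchy_schwarz]) (simp add: mult_left_mono norm_mult_le_spectral_norm)
  finally have "norm ?x * norm ?x \<le> (spectral_norm M * norm y) * norm ?x"
    by (simp add: mult_ac)
  then show ?thesis using False by (simp add: mult_le_cancel_right)
qed (simp add: spectral_norm_nonneg)

lemma norm_matrix_vector_le: "norm (A *v x) \<le> norm A * norm x" for A :: "real^'q^'p"
proof -
  have "norm (A *v x) \<le> L2_set (\<lambda>i. norm (A $ i) * norm x) UNIV"
    unfolding norm_vec_def[of "A *v x"]
    by (rule L2_set_mono) (simp_all add: matrix_vector_mul_component Cauchy_Schwarz_ineq2)
  then show ?thesis by (simp add: L2_set_left_distrib norm_vec_def[of A])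
qed

text \<open>The easy half of duality: Cauchy-Schwarz in each term of the trace formula over a
  singular basis of \<open>M\<close>.\<close>

lemma inner_le_nuclear_norm:
  fixes Z M :: "real^'q^'p"
  assumes "\<And>x. norm (Z *v x) \<le> c * norm x"
  shows "Z \<bullet> M \<le> c * nuclear_norm M"
proof -
  obtain v where sb: "singular_basis M v" using ex_singular_basis by blast
  note orth = singular_basisD[OF sb]
  have "Z \<bullet> M = (\<Sum>k<CARD('q). (Z *v v k) \<bullet> (M *v v k))"
    by (rule inner_matrix_orthonormal[OF orth(1)])
  also have "\<dots> \<le> (\<Sum>k<CARD('q). c * norm (M *v v k))"
  proof (rule sum_mono)
    fix k assume "k \<in> {..<CARD('q)}"
    then have "norm (v k) = 1" by (simp add: norm_eq_1 orth(1))
    then have "norm (Z *v v k) \<le> c" using assms[of "v k"] by simp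
    then show "(Z *v v k) \<bullet> (M *v v k) \<le> c * norm (M *v v k)"
      by (meson mult_right_mono norm_cauchy_schwarz norm_ge_zero order_trans)
  qed
  finally show ?thesis by (simp add: nuclear_norm_singular_basis[OF sb] sum_distrib_left)
qed

text \<open>The bound of duality is attained by the partial isometry of the polar decomposition,
  which sends each \<open>v k\<close> to the normalised image \<open>u k\<close>.\<close>

lemma ex_nuclear_norm_dual:
  fixes M :: "real^'q^'p"
  obtains Z where "\<And>x. norm (Z *v x) \<le> norm x" "Z \<bullet> M = nuclear_norm M"
proof -
  obtain v where sb: "singular_basis M v" using ex_singular_basis by blast
  note orth = singular_basisD[OF sb]
  \<comment> \<open>Since \<open>1 / 0 = 0\<close>, \<open>u k\<close> is zero where the image
    vanishes, and \<open>Z\<close> is then still a contraction.\<close>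
  define u where "u k = (1 / norm (M *v v k)) *\<^sub>R (M *v v k)" for k
  define Z :: "real^'q^'p" where "Z = (\<chi> i j. \<Sum>k<CARD('q). v k $ j * u k $ i)"
  have Zx: "Z *v x = (\<Sum>k<CARD('q). (v k \<bullet> x) *\<^sub>R u k)" for x
  proof -
    have "(\<Sum>j\<in>UNIV. (\<Sum>k<CARD('q). v k $ j * u k $ i) * x $ j)
        = (\<Sum>k<CARD('q). (\<Sum>j\<in>UNIV. v k $ j * x $ j) * u k $ i)" for i
      unfolding sum_distrib_right by (subst sum.swap) (simp add: mult_ac)
    then show ?thesis
      by (simp add: vec_eq_iff matrix_vector_mult_def Z_def inner_vec_def)
  qed
  show ?thesis
  proof (rule that[of Z])
    fix x
    have "(norm (Z *v x))\<^sup>2 = (\<Sum>k<CARD('q). (v k \<bullet> x)\<^sup>2 * (norm (u k))\<^sup>2)"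
      unfolding Zx by (rule norm_sum_orthogonal) (simp_all add: u_def orth(2))
    also have "\<dots> \<le> (\<Sum>k<CARD('q). (v k \<bullet> x)\<^sup>2 * 1)"
      by (intro sum_mono mult_left_mono) (auto simp: u_def)
    also have "\<dots> = (norm x)\<^sup>2"
      using orthonormal_sum_power2[OF orth(1), of x] by simp
    finally show "norm (Z *v x) \<le> norm x" by (rule power2_le_imp_le) simp
  next
    have "Z *v v k = u k" if "k < CARD('q)" for k
    proof -
      have "Z *v v k = (\<Sum>j<CARD('q). if j = k then u k else 0)"
        unfolding Zx by (rule sum.cong) (auto simp: orth(1) that)
      then show ?thesis using that by simp
    qed
    moreover have "u k \<bullet> (M *v v k) = norm (M *v v k)" for k
      by (auto simp: u_def power2_norm_eq_inner[symmetric] power2_eq_square)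
    moreover have "Z \<bullet> M = (\<Sum>k<CARD('q). (Z *v v k) \<bullet> (M *v v k))"
      by (rule inner_matrix_orthonormal[OF orth(1)])
    ultimately show "Z \<bullet> M = nuclear_norm M"
      by (simp add: nuclear_norm_singular_basis[OF sb])
  qed
qed

text \<open>Pairing with the dual matrix \<open>Z\<close> of the combination is linear and bounded
  by the nuclear norm at both end points.\<close>

lemma nuclear_norm_convex:
  fixes A B :: "real^'q^'p"
  assumes "0 \<le> t" "t \<le> 1"
  shows "nuclear_norm ((1 - t) *\<^sub>R A + t *\<^sub>R B) \<le> (1 - t) * nuclear_norm A + t * nuclear_norm B"
proof -
  obtain Z :: "real^'q^'p" where Z: "\<And>x. norm (Z *v x) \<le> norm x"
    "Z \<bullet> ((1 - t) *\<^sub>R A + t *\<^sub>R B) = nuclear_norm ((1 - t) *\<^sub>R A + t *\<^sub>R B)"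
    using ex_nuclear_norm_dual by blast
  have "Z \<bullet> D \<le> nuclear_norm D" for D using inner_le_nuclear_norm[of Z 1 D] Z(1) by simp
  then have "(1 - t) * (Z \<bullet> A) + t * (Z \<bullet> B) \<le> (1 - t) * nuclear_norm A + t * nuclear_norm B"
    using assms by (intro add_mono mult_left_mono) auto
  then show ?thesis unfolding Z(2)[symmetric] by (simp add: inner_add_right)
qed

lemma nuclear_norm_zero: "nuclear_norm (0 :: real^'q^'p) = 0"
  by (rule ex_nuclear_norm_dual[of "0 :: real^'q^'p"]) simp

lemma nuclear_norm_scaleR_le:
  fixes A :: "real^'q^'p"
  assumes "0 \<le> c"
  shows "nuclear_norm (c *\<^sub>R A) \<le> c * nuclear_norm A"
proof -
  obtain Z :: "real^'q^'p" where Z: "\<And>x. norm (Z *v x) \<le> norm x" "Z \<bullet> (c *\<^sub>R A) = nuclear_norm (c *\<^sub>R A)"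
    using ex_nuclear_norm_dual by blast
  have "Z \<bullet> A \<le> nuclear_norm A" using inner_le_nuclear_norm[of Z 1 A] Z(1) by simp
  then show ?thesis unfolding Z(2)[symmetric] using assms by (simp add: mult_left_mono)
qed

lemma nuclear_norm_add_le: "nuclear_norm (A + B) \<le> nuclear_norm A + nuclear_norm B"
  for A B :: "real^'q^'p"
proof -
  have "nuclear_norm (2 *\<^sub>R ((1 - 1/2) *\<^sub>R A + (1/2) *\<^sub>R B))
      \<le> 2 * nuclear_norm ((1 - 1/2) *\<^sub>R A + (1/2) *\<^sub>R B)"
    by (rule nuclear_norm_scaleR_le) simp
  also have "\<dots> \<le> 2 * ((1 - 1/2) * nuclear_norm A + (1/2) * nuclear_norm B)"
    by (intro mult_left_mono nuclear_norm_convex) auto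
  finally show ?thesis by (simp add: scaleR_add_right)
qed

lemma inner_rank_one: "A \<bullet> (\<chi> i j. u $ i * w $ j) = u \<bullet> (A *v w)" for A :: "real^'q^'p"
  by (simp add: inner_vec_def matrix_vector_mult_def sum_distrib_left mult_ac)

text \<open>Rank-one matrices are the test directions that later turn a bound on inner products into
  a bound on the spectral norm.\<close>

lemma nuclear_norm_rank_one_le:
  fixes u :: "real^'p" and w :: "real^'q"
  shows "nuclear_norm (\<chi> i j. u $ i * w $ j) \<le> norm u * norm w"
proof -
  obtain Z :: "real^'q^'p" where Z: "\<And>x. norm (Z *v x) \<le> norm x"
    "Z \<bullet> (\<chi> i j. u $ i * w $ j) = nuclear_norm (\<chi> i j. u $ i * w $ j)"
    using ex_nuclear_norm_dual by blast
  have "u \<bullet> (Z *v w) \<le> norm u * norm w"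
    by (rule order_trans[OF norm_cauchy_schwarz]) (simp add: mult_left_mono Z(1))
  then show ?thesis using Z(2) by (simp add: inner_rank_one)
qed

section \<open>Variational inequality at a minimiser\<close>

lemma inner_matrix_mult_transpose: "R \<bullet> (X ** H) = (transpose X ** R) \<bullet> H"
  for X :: "real^'p^'n" and R :: "real^'q^'n"
proof -
  have "R \<bullet> (X ** H) = (\<Sum>i\<in>UNIV. \<Sum>j\<in>UNIV. \<Sum>k\<in>UNIV. X $ i $ k * R $ i $ j * H $ k $ j)"
    by (simp add: inner_vec_def matrix_matrix_mult_def sum_distrib_left mult_ac)
  also have "\<dots> = (\<Sum>i\<in>UNIV. \<Sum>k\<in>UNIV. \<Sum>j\<in>UNIV. X $ i $ k * R $ i $ j * H $ k $ j)"
    by (intro sum.cong[OF refl] sum.swap)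
  also have "\<dots> = (\<Sum>k\<in>UNIV. \<Sum>i\<in>UNIV. \<Sum>j\<in>UNIV. X $ i $ k * R $ i $ j * H $ k $ j)"
    by (rule sum.swap)
  also have "\<dots> = (\<Sum>k\<in>UNIV. \<Sum>j\<in>UNIV. \<Sum>i\<in>UNIV. X $ i $ k * R $ i $ j * H $ k $ j)"
    by (intro sum.cong[OF refl] sum.swap)
  also have "\<dots> = (transpose X ** R) \<bullet> H"
    by (simp add: inner_vec_def matrix_matrix_mult_def transpose_def sum_distrib_right)
  finally show ?thesis .
qed

lemma matrix_diff_ldistrib: "A ** (B - C) = A ** B - A ** C" for A :: "real^'n^'m"
  by (simp add: vec_eq_iff matrix_matrix_mult_def right_diff_distrib sum_subtractf)

lemma matrix_mult_scaleR_right: "A ** (c *\<^sub>R B) = c *\<^sub>R (A ** B)" for A :: "real^'n^'m"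
  by (simp add: vec_eq_iff matrix_matrix_mult_def sum_distrib_left mult_ac)

text \<open>Compare \<open>B\<close> with points on the segment towards \<open>D\<close>. The
  quadratic part is expanded exactly, the nuclear norm is bounded by convexity, and letting the step
  \<open>t\<close> shrink leaves the first-order term; no subgradients are needed.\<close>

lemma arg_min_variational_inequality:
  fixes X :: "real^'p^'n" and Y :: "real^'q^'n" and B D :: "real^'q^'p"
  assumes min: "is_arg_min (objective X Y lam) (\<lambda>_. True) B" and lam: "0 \<le> lam"
  shows "(transpose X ** (Y - X ** B)) \<bullet> (D - B) \<le> lam * (nuclear_norm D - nuclear_norm B)"
proof -
  define R where "R = Y - X ** B"
  define H where "H = X ** (D - B)"
  define a where "a = R \<bullet> H - lam * (nuclear_norm D - nuclear_norm B)"
  define b where "b = (norm H)\<^sup>2 / 2"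
  have *: "a \<le> t * b" if t: "0 < t" "t \<le> 1" for t
  proof -
    let ?B = "(1 - t) *\<^sub>R B + t *\<^sub>R D"
    have "Y - X ** ?B = R - t *\<^sub>R H"
      by (simp add: R_def H_def matrix_add_ldistrib matrix_diff_ldistrib matrix_mult_scaleR_right algebra_simps)
    then have "objective X Y lam ?B = 1/2 * (norm (R - t *\<^sub>R H))\<^sup>2 + lam * nuclear_norm ?B"
      by (simp add: objective_def frobenius_norm_eq_norm)
    moreover have "objective X Y lam B \<le> objective X Y lam ?B"
      using min by (auto simp: is_arg_min_def not_less)
    moreover have "objective X Y lam B = 1/2 * (norm R)\<^sup>2 + lam * nuclear_norm B"
      by (simp add: objective_def frobenius_norm_eq_norm R_def)
    moreover have "lam * nuclear_norm ?B \<le> lam * ((1 - t) * nuclear_norm B + t * nuclear_norm D)"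
      using t lam by (intro mult_left_mono nuclear_norm_convex) auto
    moreover have "(norm (R - t *\<^sub>R H))\<^sup>2 = (norm R)\<^sup>2 - 2 * t * (R \<bullet> H) + t\<^sup>2 * (norm H)\<^sup>2"
      unfolding power2_norm_eq_inner
      by (simp add: inner_diff_left inner_diff_right inner_commute[of H R] power2_eq_square algebra_simps)
    ultimately have "t * a \<le> t * (t * b)"
      by (simp add: a_def b_def algebra_simps power2_eq_square)
    then show ?thesis using t by simp
  qed
  have "a \<le> 0"
  proof (rule ccontr)
    \<comment> \<open>If \<open>a > 0\<close>, then \<open>a \<le> b\<close> makes
      \<open>t = a / (2 * b)\<close> an admissible step, for which the bound reads
      \<open>a \<le> a / 2\<close>.\<close>
    assume "\<not> a \<le> 0"
    moreover have "a \<le> b" using *[of 1] by simp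
    ultimately show False using *[of "a / (2 * b)"] by (simp add: field_simps)
  qed
  then show ?thesis by (simp add: a_def R_def H_def inner_matrix_mult_transpose)
qed

section \<open>Rank, dimension counting and the equality case of duality\<close>

text \<open>By the ordering all images from index \<open>m\<close> on vanish, so the first
  \<open>m\<close> images span the range.\<close>

lemma rank_le_singular_basis:
  fixes M :: "real^'q^'p"
  assumes sb: "singular_basis M v" and m: "m < CARD('q)" and z: "M *v v m = 0"
  shows "rank M \<le> m"
proof -
  note orth = singular_basisD[OF sb]
  have z': "M *v v k = 0" if "m \<le> k" "k < CARD('q)" for k
    using orth(3)[OF that] z by simp
  let ?E = "(\<lambda>k. M *v v k) ` {..<m}"
  have "M *v x \<in> span ?E" for x
  proof -
    have "M *v x = (\<Sum>k<CARD('q). (v k \<bullet> x) *\<^sub>R (M *v v k))"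
      using matrix_vector_mult_sum_scaleR[of M "\<lambda>k. v k \<bullet> x" v "{..<CARD('q)}"]
      by (simp only: orthonormal_expansion[OF orth(1)])
    also have "\<dots> = (\<Sum>k<m. (v k \<bullet> x) *\<^sub>R (M *v v k))"
      using m z' by (intro sum.mono_neutral_right) auto
    also have "\<dots> \<in> span ?E"
      by (intro span_sum span_scale span_base) auto
    finally show ?thesis .
  qed
  then have "rank M \<le> card ?E"
    unfolding rank_dim_range by (intro dim_le_card) auto
  also have "\<dots> \<le> m" using card_image_le[of "{..<m}"] by simp
  finally show ?thesis .
qed

text \<open>A dimension count: \<open>m\<close> linear conditions leave a nonzero vector in a space
  of dimension \<open>m + 1\<close>.\<close>

lemma ex_orthogonal_in_span:
  fixes v w :: "nat \<Rightarrow> 'a::euclidean_space"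
  assumes orth: "\<And>j k. \<lbrakk>j \<le> m; k \<le> m\<rbrakk> \<Longrightarrow> v j \<bullet> v k = (if j = k then 1 else 0)"
  obtains x where "x \<in> span (v ` {..m})" "x \<noteq> 0" "\<And>k. k < m \<Longrightarrow> w k \<bullet> x = 0"
proof -
  have inj: "inj_on v {..m}"
    by (rule inj_onI) (metis atMost_iff orth zero_neq_one)
  have "pairwise orthogonal (v ` {..m})" using orth by (auto simp: pairwise_def orthogonal_def)
  moreover have "0 \<notin> v ` {..m}" using orth by (auto, metis inner_zero_left zero_neq_one)
  ultimately have "independent (v ` {..m})" by (rule pairwise_orthogonal_independent)
  then have dimV: "dim (span (v ` {..m})) = m + 1"
    using inj by (simp add: dim_eq_card_independent card_image)
  \<comment> \<open>The projection of \<open>w k\<close> onto the span of the \<open>v j\<close>: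
    for a vector in that span, orthogonality to \<open>p k\<close> and to \<open>w k\<close> are the
    same.\<close>
  define p where "p k = (\<Sum>j\<le>m. (v j \<bullet> w k) *\<^sub>R v j)" for k
  have "p k \<in> span (v ` {..m})" for k
    unfolding p_def by (intro span_sum span_scale span_base) auto
  then have sub: "span (p ` {..<m}) \<subseteq> span (v ` {..m})"
    by (intro span_minimal) auto
  have "dim (span (p ` {..<m})) \<le> card (p ` {..<m})"
    by (simp add: dim_le_card')
  also have "\<dots> \<le> m" using card_image_le[of "{..<m}" p] by simp
  finally have "dim (span (p ` {..<m})) < dim (span (v ` {..m}))" using dimV by simp
  then have "span (p ` {..<m}) \<subset> span (v ` {..m})" using sub by (metis less_irrefl psubsetI)
  then obtain x where x: "x \<noteq> 0" "x \<in> span (v ` {..m})"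
      "\<And>y. y \<in> span (p ` {..<m}) \<Longrightarrow> orthogonal x y"
    by (rule orthogonal_to_subspace_exists_gen) blast
  have "w k \<bullet> x = 0" if k: "k < m" for k
  proof -
    have "orthogonal (w k - p k) (v i)" if "i \<le> m" for i
    proof -
      have "(\<Sum>j\<le>m. (v j \<bullet> w k) * (v j \<bullet> v i)) = (\<Sum>j\<le>m. if j = i then v i \<bullet> w k else 0)"
        using that by (intro sum.cong) (auto simp: orth)
      then show ?thesis
        using that by (simp add: orthogonal_def p_def inner_diff_left inner_sum_left inner_commute[of "w k"])
    qed
    then have "orthogonal (w k - p k) x"
      by (intro orthogonal_to_span[OF x(2)]) auto
    moreover have "orthogonal x (p k)" using k by (intro x(3) span_base) auto
    ultimately show ?thesis
      by (simp add: orthogonal_def inner_diff_left inner_commute[of x "p k"])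
  qed
  with x show ?thesis using that by blast
qed

text \<open>Equality in duality forces equality in each Cauchy-Schwarz step, so \<open>G\<close>
  sends \<open>v 0\<close> to \<open>v m\<close> to \<open>c\<close> times the normalised images
  under \<open>B\<close>, which are again orthonormal.\<close>

lemma contraction_dual_isometric:
  fixes G B :: "real^'q^'p"
  assumes sb: "singular_basis B v"
    and G: "\<And>x. norm (G *v x) \<le> c * norm x" and GB: "G \<bullet> B = c * nuclear_norm B"
    and m: "m < CARD('q)" and nz: "B *v v m \<noteq> 0" and x: "x \<in> span (v ` {..m})"
  shows "norm (G *v x) = c * norm x"
proof -
  note orth = singular_basisD[OF sb]
  have nv: "norm (v k) = 1" if "k < CARD('q)" for k using orth(1)[OF that that] by (simp add: norm_eq_1)
  have c0: "0 \<le> c" using order_trans[OF norm_ge_zero G[of "v m"]] nv[OF m] by simp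
  have le: "(G *v v k) \<bullet> (B *v v k) \<le> c * norm (B *v v k)" if "k < CARD('q)" for k
    using G[of "v k"] nv[OF that]
    by (metis (no_types, opaque_lifting) mult.right_neutral mult_right_mono norm_cauchy_schwarz norm_ge_zero order_trans)
  have "(\<Sum>k<CARD('q). c * norm (B *v v k) - (G *v v k) \<bullet> (B *v v k)) = 0"
    using GB inner_matrix_orthonormal[OF orth(1), of G B]
    by (simp add: nuclear_norm_singular_basis[OF sb] sum_subtractf sum_distrib_left)
  then have eq: "(G *v v k) \<bullet> (B *v v k) = c * norm (B *v v k)" if "k < CARD('q)" for k
    using sum_nonneg_eq_0_iff[of "{..<CARD('q)}" "\<lambda>k. c * norm (B *v v k) - (G *v v k) \<bullet> (B *v v k)"]
      le that by auto
  have Gv: "G *v v k = (c / norm (B *v v k)) *\<^sub>R (B *v v k)" if k: "k \<le> m" for k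
  proof -
    have kq: "k < CARD('q)" using k m by simp
    have nzk: "norm (B *v v k) > 0" using orth(3)[OF k m] nz by (meson less_le_trans zero_less_norm_iff)
    let ?b = "B *v v k" and ?g = "G *v v k"
    \<comment> \<open>Equality in Cauchy-Schwarz made explicit: the squared distance between the two
      vectors is at most 0.\<close>
    have "(norm (?g - (c / norm ?b) *\<^sub>R ?b))\<^sup>2
        = (norm ?g)\<^sup>2 - 2 * (c / norm ?b) * (?g \<bullet> ?b) + (c / norm ?b)\<^sup>2 * (norm ?b)\<^sup>2"
      unfolding power2_norm_eq_inner
      by (simp add: inner_diff_left inner_diff_right inner_commute[of ?b ?g] power2_eq_square algebra_simps)
    also have "\<dots> = (norm ?g)\<^sup>2 - c\<^sup>2"
      using nzk by (simp add: eq[OF kq] power_divide power2_eq_square)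
    also have "\<dots> \<le> 0"
      using power_mono[OF G[of "v k"], of 2] nv[OF kq] by simp
    finally show ?thesis by simp
  qed
  have perp: "v k \<bullet> x = 0" if "m < k" "k < CARD('q)" for k
  proof -
    have "orthogonal (v k) x"
      by (rule orthogonal_to_span[OF x]) (use that in \<open>auto simp: orthogonal_def orth(1)\<close>)
    then show ?thesis by (simp add: orthogonal_def)
  qed
  define u where "u k = (1 / norm (B *v v k)) *\<^sub>R (B *v v k)" for k
  have nu: "norm (u k) = 1" if "k \<le> m" for k
    using orth(3)[OF that m] nz by (auto simp: u_def)
  have "G *v x = (\<Sum>k<CARD('q). (v k \<bullet> x) *\<^sub>R (G *v v k))"
    using matrix_vector_mult_sum_scaleR[of G "\<lambda>k. v k \<bullet> x" v "{..<CARD('q)}"]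
    by (simp only: orthonormal_expansion[OF orth(1)])
  also have "\<dots> = (\<Sum>k\<le>m. (v k \<bullet> x) *\<^sub>R (G *v v k))"
    using m perp by (intro sum.mono_neutral_right) auto
  also have "\<dots> = (\<Sum>k\<le>m. (c * (v k \<bullet> x)) *\<^sub>R u k)"
    by (intro sum.cong) (auto simp: Gv u_def)
  finally have "(norm (G *v x))\<^sup>2 = (\<Sum>k\<le>m. (c * (v k \<bullet> x))\<^sup>2 * (norm (u k))\<^sup>2)"
    by (simp only:) (rule norm_sum_orthogonal, use m in \<open>simp_all add: u_def orth(2)\<close>)
  also have "\<dots> = c\<^sup>2 * (\<Sum>k\<le>m. (v k \<bullet> x)\<^sup>2)"
    by (simp add: nu power_mult_distrib sum_distrib_left)
  also have "(\<Sum>k\<le>m. (v k \<bullet> x)\<^sup>2) = (\<Sum>k<CARD('q). (v k \<bullet> x)\<^sup>2)"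
    using m perp by (intro sum.mono_neutral_left) auto
  also have "\<dots> = (norm x)\<^sup>2"
    by (rule orthonormal_sum_power2[OF orth(1)])
  finally have "(norm (G *v x))\<^sup>2 = (c * norm x)\<^sup>2" by (simp add: power_mult_distrib)
  then show ?thesis using c0 by (simp add: power2_eq_iff_nonneg)
qed

section \<open>Optimality conditions and location of the residual\<close>

text \<open>The variational inequality is tested at three points: \<open>0\<close> and
  \<open>2 *\<^sub>R B\<close> give the two halves of the equation, and a rank-one perturbation of
  \<open>B\<close> gives the norm bound.\<close>

lemma arg_min_optimality:
  fixes X :: "real^'p^'n" and Y :: "real^'q^'n" and B :: "real^'q^'p"
  assumes min: "is_arg_min (objective X Y lam) (\<lambda>_. True) B" and lam: "0 \<le> lam"
  defines "G \<equiv> transpose X ** (Y - X ** B)"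
  shows "norm (G *v x) \<le> lam * norm x" and "G \<bullet> B = lam * nuclear_norm B"
proof -
  have var: "G \<bullet> (D - B) \<le> lam * (nuclear_norm D - nuclear_norm B)" for D
    unfolding G_def by (rule arg_min_variational_inequality[OF min lam])
  have "lam * nuclear_norm (2 *\<^sub>R B) \<le> lam * (2 * nuclear_norm B)"
    using lam by (intro mult_left_mono nuclear_norm_scaleR_le) auto
  then show "G \<bullet> B = lam * nuclear_norm B"
    using var[of 0] var[of "2 *\<^sub>R B"]
    by (simp add: nuclear_norm_zero scaleR_2 algebra_simps)
  show "norm (G *v x) \<le> lam * norm x"
  proof (cases "G *v x = 0")
    case False
    \<comment> \<open>Chosen so that \<open>G \<bullet> E\<close> is the square of
      \<open>norm (G *v x)\<close>, while the nuclear norm of \<open>E\<close> is at most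
      \<open>norm (G *v x) * norm x\<close>.\<close>
    define E :: "real^'q^'p" where "E = (\<chi> i j. (G *v x) $ i * x $ j)"
    have "norm (G *v x) * norm (G *v x) = G \<bullet> E"
      by (simp add: E_def inner_rank_one power2_norm_eq_inner[symmetric] power2_eq_square)
    also have "\<dots> \<le> lam * (nuclear_norm (B + E) - nuclear_norm B)" using var[of "B + E"] by simp
    also have "\<dots> \<le> lam * (norm (G *v x) * norm x)"
      using nuclear_norm_add_le[of B E] nuclear_norm_rank_one_le[of "G *v x" x] lam
      by (intro mult_left_mono) (simp_all add: E_def)
    finally have "norm (G *v x) * norm (G *v x) \<le> (lam * norm x) * norm (G *v x)"
      by (simp add: mult_ac)
    then show ?thesis using False by (simp add: mult_le_cancel_right)
  qed (simp add: lam)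
qed

text \<open>The residual divided by \<open>lam\<close> is the projection of \<open>Y / lam\<close> onto the matrices \<open>\<theta>\<close> for
  which \<open>X\<^sup>T \<theta>\<close> has spectral norm at most 1, a set that contains \<open>Y / \<sigma>\<^sub>1\<close>.  The obtuse angle at the
  projection puts it into the ball with diameter from \<open>Y / lam\<close> to \<open>Y / \<sigma>\<^sub>1\<close>.\<close>

lemma residual_in_ball:
  fixes X :: "real^'p^'n" and Y :: "real^'q^'n" and B :: "real^'q^'p"
  assumes min: "is_arg_min (objective X Y lam) (\<lambda>_. True) B"
    and lam: "0 \<le> lam" "lam \<le> s" and s: "s = spectral_norm (transpose X ** Y)" "0 < s"
  shows "norm ((Y - X ** B) - ((1 + lam / s) / 2) *\<^sub>R Y) \<le> (1 - lam / s) / 2 * norm Y"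
proof -
  let ?R = "Y - X ** B" and ?C = "transpose X ** Y"
  \<comment> \<open>Everything is multiplied by \<open>lam\<close>: the end points of the diameter
    become \<open>Y\<close> and \<open>t *\<^sub>R Y\<close>.\<close>
  define t where "t = lam / s"
  have t: "0 \<le> t" "t \<le> 1" using lam s by (simp_all add: t_def)
  have CB: "?C \<bullet> B \<le> s * nuclear_norm B"
    unfolding s(1) by (rule inner_le_nuclear_norm) (rule norm_mult_le_spectral_norm)
  have "Y - ?R = X ** B" by simp
  then have "(Y - ?R) \<bullet> (t *\<^sub>R Y - ?R) = (transpose X ** (t *\<^sub>R Y - ?R)) \<bullet> B"
    by (metis inner_commute inner_matrix_mult_transpose)
  also have "\<dots> = t * (?C \<bullet> B) - (transpose X ** ?R) \<bullet> B"
    by (simp only: matrix_diff_ldistrib[of "transpose X" "t *\<^sub>R Y"] matrix_mult_scaleR_right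
        inner_diff_left inner_scaleR_left)
  also have "\<dots> = t * (?C \<bullet> B) - t * (s * nuclear_norm B)"
    using arg_min_optimality(2)[OF min lam(1)] s by (simp add: t_def)
  also have "\<dots> \<le> 0" using mult_left_mono[OF CB t(1)] by simp
  finally have obtuse: "(Y - ?R) \<bullet> (t *\<^sub>R Y - ?R) \<le> 0" .
  \<comment> \<open>Thales: seeing the diameter under an obtuse or right angle is the same as lying
    in the ball around its midpoint.\<close>
  have "(norm (?R - ((1 + t) / 2) *\<^sub>R Y))\<^sup>2
      = (norm (((1 - t) / 2) *\<^sub>R Y))\<^sup>2 + (Y - ?R) \<bullet> (t *\<^sub>R Y - ?R)"
    unfolding power2_norm_eq_inner
    by (simp only: inner_diff_left inner_diff_right inner_scaleR_left inner_scaleR_right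
        inner_commute[of "X ** B" Y]) (simp add: field_simps)
  also have "\<dots> \<le> (norm (((1 - t) / 2) *\<^sub>R Y))\<^sup>2" using obtuse by simp
  finally have "norm (?R - ((1 + t) / 2) *\<^sub>R Y) \<le> norm (((1 - t) / 2) *\<^sub>R Y)"
    by (rule power2_le_imp_le) simp
  then show ?thesis using t by (simp add: t_def)
qed

section \<open>The rank bound\<close>

theorem theorem3p6:
  fixes X :: "real^'p^'n" and Y :: "real^'q^'n"
    and r i :: nat and lam :: real and B :: "real^'q^'p"
  assumes "r = min CARD('p) CARD('q)"
    and "\<exists>j\<in>{1..r}. \<exists>k\<in>{1..r}.
           singular_value (transpose X ** Y) j \<noteq> singular_value (transpose X ** Y) k"
    and "i \<in> {2..r}"
    and "lam \<in> {rank_threshold X Y i <.. rank_threshold X Y (i - 1)}"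
    and "is_arg_min (objective X Y lam) (\<lambda>_. True) B"
  shows "rank B \<le> i - 1"
proof (rule ccontr)
  assume rank: "\<not> rank B \<le> i - 1"
  let ?C = "transpose X ** Y"
  define s where "s = spectral_norm ?C"
  define a where "a = spectral_norm X * norm Y"
  obtain w where w: "singular_basis ?C w" using ex_singular_basis by blast
  obtain v where v: "singular_basis B v" using ex_singular_basis by blast
  have sv: "singular_value ?C k = norm (?C *v w (k - 1))" if "k \<in> {1..r}" for k
    using singular_value_singular_basis[OF w] that assms(1) by (simp add: min_dim_def)
  have s_eq: "s = norm (?C *v w 0)" by (simp add: s_def spectral_norm_singular_basis[OF w])
  have sv_le: "singular_value ?C k \<le> s" if "k \<in> {1..r}" for k
    unfolding sv[OF that] s_eq using that assms(1) by (intro singular_basisD(3)[OF w]) auto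
  have sv_ge: "0 \<le> singular_value ?C k" if "k \<in> {1..r}" for k by (simp add: sv[OF that])
  \<comment> \<open>All singular values lie between 0 and \<open>s\<close>, so two different ones
    exclude \<open>s = 0\<close>.\<close>
  have s: "0 < s"
  proof (rule ccontr)
    assume "\<not> 0 < s"
    then have "singular_value ?C k = 0" if "k \<in> {1..r}" for k
      using sv_le[OF that] sv_ge[OF that] by simp
    then show False using assms(2) by auto
  qed
  have a: "0 \<le> a" by (simp add: a_def spectral_norm_nonneg)
  have thr: "rank_threshold X Y k = s * (a + singular_value ?C k) / (2 * s - singular_value ?C k + a)" for k
    by (simp add: rank_threshold_def s_def a_def frobenius_norm_eq_norm Let_def)
  have pos: "0 < 2 * s - singular_value ?C k + a" if "k \<in> {1..r}" for k
    using sv_le[OF that] s a by simp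
  have i: "i \<in> {1..r}" "i - 1 \<in> {1..r}" "i - 1 < CARD('q)" using assms(1,3) by auto
  have "0 \<le> rank_threshold X Y i"
    unfolding thr using sv_ge[OF i(1)] pos[OF i(1)] s a by (intro divide_nonneg_pos) auto
  then have lam0: "0 < lam" using assms(4) by simp
  \<comment> \<open>This is where the upper end of the interval for \<open>lam\<close> enters: it
    gives \<open>lam \<le> s\<close>, hence \<open>t \<le> 1\<close>.\<close>
  have "rank_threshold X Y (i - 1) \<le> s"
  proof -
    have "s * (a + singular_value ?C (i - 1)) \<le> s * (2 * s - singular_value ?C (i - 1) + a)"
      using s sv_le[OF i(2)] by (intro mult_left_mono) auto
    then show ?thesis unfolding thr using pos[OF i(2)] by (simp add: pos_divide_le_eq)
  qed
  then have lams: "lam \<le> s" using assms(4) by simp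
  define t where "t = lam / s"
  have t: "0 \<le> t" "t \<le> 1" "lam = t * s" using lam0 lams s by (simp_all add: t_def)
  let ?R = "Y - X ** B" let ?S = "?R - ((1 + t) / 2) *\<^sub>R Y"
  \<comment> \<open>Index \<open>i - 1\<close> is the \<open>i\<close>-th basis vector, so
    \<open>x\<close> below is sought in a span of dimension \<open>i\<close> under
    \<open>i - 1\<close> conditions.\<close>
  have nz: "B *v v (i - 1) \<noteq> 0" using rank rank_le_singular_basis[OF v i(3)] by blast
  obtain x where x: "x \<in> span (v ` {..i - 1})" "x \<noteq> 0" "\<And>k. k < i - 1 \<Longrightarrow> w k \<bullet> x = 0"
    by (rule ex_orthogonal_in_span[of "i - 1" v w]) (use i(3) in \<open>auto simp: singular_basisD(1)[OF v]\<close>)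
  have "lam * norm x = norm ((transpose X ** ?R) *v x)"
    using contraction_dual_isometric[OF v arg_min_optimality[OF assms(5)] i(3) nz x(1)] lam0 by simp
  \<comment> \<open>The residual is split into the centre of the ball, which yields the term with
    \<open>?C\<close>, and the deviation \<open>?S\<close>, bounded by the radius.\<close>
  also have "(transpose X ** ?R) *v x = ((1 + t) / 2) *\<^sub>R (?C *v x) + transpose X *v (?S *v x)"
    by (simp add: matrix_vector_mul_assoc[symmetric] matrix_vector_mult_diff_rdistrib
        matrix_vector_mult_diff_distrib scaleR_matrix_vector_assoc[symmetric] matrix_vector_mult_scaleR)
  also have "norm \<dots> \<le> (1 + t) / 2 * norm (?C *v x) + norm (transpose X *v (?S *v x))"
    using t by (intro order_trans[OF norm_triangle_ineq]) simp
  also have "\<dots> \<le> (1 + t) / 2 * (singular_value ?C i * norm x) + (1 - t) / 2 * a * norm x"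
  proof (rule add_mono)
    show "(1 + t) / 2 * norm (?C *v x) \<le> (1 + t) / 2 * (singular_value ?C i * norm x)"
      unfolding sv[OF i(1)] using t by (intro mult_left_mono norm_mult_le_singular[OF w i(3) x(3)]) auto
    have "norm (transpose X *v (?S *v x)) \<le> spectral_norm X * norm (?S *v x)"
      by (rule norm_transpose_mult_le_spectral_norm)
    also have "\<dots> \<le> spectral_norm X * (norm ?S * norm x)"
      by (intro mult_left_mono norm_matrix_vector_le spectral_norm_nonneg)
    also have "\<dots> \<le> spectral_norm X * (((1 - t) / 2 * norm Y) * norm x)"
      using residual_in_ball[OF assms(5) _ lams s_def s] lam0
      by (intro mult_left_mono mult_right_mono spectral_norm_nonneg) (auto simp: t_def)
    finally show "norm (transpose X *v (?S *v x)) \<le> (1 - t) / 2 * a * norm x"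
      by (simp add: a_def mult_ac)
  qed
  finally have "lam * norm x \<le> ((1 + t) / 2 * singular_value ?C i + (1 - t) / 2 * a) * norm x"
    by (simp only: distrib_right mult.assoc)
  then have "lam \<le> (1 + t) / 2 * singular_value ?C i + (1 - t) / 2 * a"
    using x(2) by (simp add: mult_le_cancel_right)
  \<comment> \<open>The factor \<open>2 * s\<close> clears the fractions, since
    \<open>t * s = lam\<close>; the result is linear in \<open>lam\<close> and can be solved for
    it.\<close>
  then have "2 * s * lam \<le> 2 * s * ((1 + t) / 2 * singular_value ?C i + (1 - t) / 2 * a)"
    using s by (intro mult_left_mono) auto
  also have "\<dots> = (s + lam) * singular_value ?C i + (s - lam) * a"
    by (simp add: t(3) field_simps)
  finally have "lam * (2 * s - singular_value ?C i + a) \<le> s * (a + singular_value ?C i)"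
    by (simp add: algebra_simps)
  then have "lam \<le> rank_threshold X Y i"
    unfolding thr using pos[OF i(1)] by (simp add: pos_le_divide_eq)
  then show False using assms(4) by simp
qed

end
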